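(* Let $A$ be a finite alphabet that is the disjoint union of two subalphabets $A_1$ and $A_2$, let $\psi_1\colon A_1^+\to T_1$ and $\psi_2\colon A_2^+\to T_2$ be semigroup homomorphisms with $T_1$ and $T_2$ finite semigroups, and let $\chi\colon (T_1\times T_2)^+\to T_0$ be a homomorphism to a semigroup $T_0$. Let $\tau\colon A^+\to T_2^I\times T_0^I\times T_1^I$ be the associated function, and let $\psi_M\colon A^+\to T_M$ be the merge decomposition of $A^+$ along $\chi$, $\psi_1$ and $\psi_2$ (all as defined in the context). Then there exists a function $f\colon T_M\to T_2^I\times T_0^I\times T_1^I$ such that $f\circ\psi_M = \tau$.
   Context: For a set $B$, $B^+$ and $B^*$ denote the free semigroup and free monoid on $B$; $\varepsilon$ is the empty word. In particular $(T_1\times T_2)^+$ is the free semigroup on the set $T_1\times T_2$, and $\chi(t_1,t_2)$ denotes the image under $\chi$ of the one-letter word $(t_1,t_2)$. Augmented semigroups. For a semigroup $T$, $T^I$ is the monoid obtained by adjoining a new identity $I$ to $T$ (even if $T$ is already a monoid); the adjoined identity of $T_i^I$ is denoted $I_i$ for $i=0,1,2$. $T^\sharp$ is the semigroup of functions on $T^I$, acting on the right of their arguments (and composed accordingly), consisting of the right multiplication maps $x\mapsto xt$ for $t\in T$ (identified with $t$) and the constant maps $t^\sharp$ with value $t$ for $t\in T^I$. Dually, $T^\flat$ is the semigroup of functions on $T^I$, acting on the left of their arguments, consisting of the left multiplication maps $x\mapsto tx$ for $t\in T$ (identified with $t$) and the constant maps $t^\flat$ with value $t$ for $t\in T^I$.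 The function $\tau$. The subsemigroup $(A_1^+A_2^+)^+$ of $A^+$ is freely generated by the set $A_1^+A_2^+$. Let $\mu\colon (A_1^+A_2^+)^+\to (T_1\times T_2)^+$ be the unique homomorphism with $\mu(w_1w_2) = (\psi_1(w_1),\psi_2(w_2))$ (a one-letter word) for $w_1\in A_1^+$, $w_2\in A_2^+$, and let $\psi_0 := \chi\circ\mu\colon (A_1^+A_2^+)^+\to T_0$. Extend each $\psi_i$ ($i=0,1,2$) to a homomorphism from the corresponding free monoid to $T_i^I$ by $\psi_i(\varepsilon) := I_i$. Every $w\in A^+$ is uniquely written as $w = v_2uv_1$ with $v_2\in A_2^*$, $u\in (A_1^+A_2^+)^*$, $v_1\in A_1^*$; put $\tau(w) := (\psi_2(v_2),\psi_0(u),\psi_1(v_1))$. Triple product. Let $(S,+)$ be a (not necessarily commutative) semigroup with a left action of a semigroup $S_L$ and a right action of a semigroup $S_R$, both by semigroup endomorphisms, which commute. The triple product $(S_R,S,S_L)$ is the semigroup of triples $(s_R,s,s_L)$ with multiplication $(s_R,s,s_L)(s_R',s',s_L') := (s_Rs_R',\, ss_R'+s_Ls',\, s_Ls_L')$. Merge semigroup and merge decomposition. Let $S := (T_0^I)^{T_1^I\times T_2^I}$ be the semigroup of all functions $T_1^I\times T_2^I\to T_0^I$ with the pointwise product of $T_0^I$, written additively. $T_1^\sharp$ acts on the left and $T_2^\flat$ on the right of $S$ by $[s_L\, s\, s_R](t_1,t_2) := s(t_1s_L, s_Rt_2)$ for $s_L\in T_1^\sharp$, $s_R\in T_2^\flat$,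 $s \in S$, $(t_1,t_2)\in T_1^I\times T_2^I$. The merge semigroup is the triple product $T_M := (T_2^\flat, S, T_1^\sharp)$. For $w_1\in A_1^+$ define $s_{w_1}\in S$ by $s_{w_1}(t_1,I_2) := I_0$ and $s_{w_1}(t_1,t_2) := \chi(t_1\psi_1(w_1),t_2)$ for all $t_1\in T_1^I$, $t_2\in T_2$. Let $i_0\in S$ be the constant function with value $I_0$. The merge decomposition of $A^+$ along $\chi,\psi_1,\psi_2$ is the unique homomorphism $\psi_M\colon A^+\to T_M$ with $\psi_M(a_1) = (I_2^\flat, s_{a_1},\psi_1(a_1))$ for $a_1\in A_1$ and $\psi_M(a_2) = (\psi_2(a_2), i_0, I_1^\sharp)$ for $a_2\in A_2$. *)

theory Defs
  imports Main "HOL-Library.FuncSet" "HOL-Library.Function_Algebras"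
begin

section \<open>Free semigroups and homomorphisms\<close>

text \<open>
  The free monoid on \<open>A\<close> is \<open>lists A\<close> with concatenation. A homomorphism on a semigroup of words
  is an HOL function on all lists whose values outside that semigroup play no role.
\<close>

definition words :: "'x set \<Rightarrow> 'x list set" where
  "words A = lists A - {[]}"

definition sg_hom_on :: "'x list set \<Rightarrow> ('m \<Rightarrow> 'm \<Rightarrow> 'm) \<Rightarrow> ('x list \<Rightarrow> 'm) \<Rightarrow> bool" where
  "sg_hom_on W f h \<longleftrightarrow> (\<forall>u\<in>W. \<forall>v\<in>W. h (u @ v) = f (h u) (h v))"

section \<open>Augmented semigroups\<close>

text \<open>
  The type \<open>'t adj\<close> is \<open>T\<^sup>I\<close>; its constructor \<open>Adj\<close> is the new identity even if \<open>T\<close> is a monoid.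
\<close>

datatype 't adj = Elt (the_elt: 't) | Adj

instantiation adj :: (semigroup_mult) monoid_mult
begin

definition one_adj :: "'a adj" where
  "1 = Adj"

fun times_adj :: "'a adj \<Rightarrow> 'a adj \<Rightarrow> 'a adj" where
  "Elt s * Elt t = Elt (s * t)"
| "Adj * y = y"
| "x * Adj = x"

instance
proof
  fix a b c :: "'a adj"
  show "a * b * c = a * (b * c)"
    by (cases a; cases b; cases c) (simp_all add: mult.assoc)
  show "1 * a = a" "a * 1 = a"
    by (cases a; simp add: one_adj_def)+
qed

end

definition ext_hom :: "('x list \<Rightarrow> 't) \<Rightarrow> 'x list \<Rightarrow> 't adj" where
  "ext_hom \<psi> w = (if w = [] then Adj else Elt (\<psi> w))"

typedef (overloaded) ('t::semigroup_mult) sharp =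
  "range (\<lambda>t x. x * Elt t) \<union> range (\<lambda>t x. t) :: ('t adj \<Rightarrow> 't adj) set"
  morphisms sharp_app Abs_sharp
  by blast

typedef (overloaded) ('t::semigroup_mult) flat =
  "range (\<lambda>t x. Elt t * x) \<union> range (\<lambda>t x. t) :: ('t adj \<Rightarrow> 't adj) set"
  morphisms flat_app Abs_flat
  by blast

setup_lifting type_definition_sharp
setup_lifting type_definition_flat

lift_definition sharp_mul :: "'t::semigroup_mult \<Rightarrow> 't sharp" is "\<lambda>t x. x * Elt t"
  by blast

lift_definition sharp_const :: "'t::semigroup_mult adj \<Rightarrow> 't sharp" is "\<lambda>t x. t"
  by blast

lift_definition flat_mul :: "'t::semigroup_mult \<Rightarrow> 't flat" is "\<lambda>t x. Elt t * x"
  by blast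

lift_definition flat_const :: "'t::semigroup_mult adj \<Rightarrow> 't flat" is "\<lambda>t x. t"
  by blast

text \<open>
  Elements of \<open>T\<close>-sharp act on the right of their arguments, so the product \<open>f * g\<close> applies \<open>f\<close> first;
  \<open>sharp_app f x\<close> is what is usually written \<open>xf\<close>.
\<close>

instantiation sharp :: (semigroup_mult) semigroup_mult
begin

lift_definition times_sharp :: "'a sharp \<Rightarrow> 'a sharp \<Rightarrow> 'a sharp" is "\<lambda>f g. g \<circ> f"
proof -
  fix f g :: "'a adj \<Rightarrow> 'a adj"
  assume "f \<in> range (\<lambda>t x. x * Elt t) \<union> range (\<lambda>t x. t)"
    and "g \<in> range (\<lambda>t x. x * Elt t) \<union> range (\<lambda>t x. t)"
  then consider s t where "f = (\<lambda>x. x * Elt s)" "g = (\<lambda>x. x * Elt t)"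
    | s where "f = (\<lambda>x. s)" | t where "g = (\<lambda>x. t)"
    by blast
  then show "g \<circ> f \<in> range (\<lambda>t x. x * Elt t) \<union> range (\<lambda>t x. t)"
  proof cases
    case (1 s t)
    then have "g \<circ> f = (\<lambda>x. x * Elt (s * t))"
      by (simp add: fun_eq_iff mult.assoc)
    then show ?thesis by blast
  qed (auto simp: comp_def)
qed

instance
  by standard (transfer, simp add: comp_assoc)

end

instantiation flat :: (semigroup_mult) semigroup_mult
begin

lift_definition times_flat :: "'a flat \<Rightarrow> 'a flat \<Rightarrow> 'a flat" is "\<lambda>f g. f \<circ> g"
proof -
  fix f g :: "'a adj \<Rightarrow> 'a adj"
  assume "f \<in> range (\<lambda>t x. Elt t * x) \<union> range (\<lambda>t x. t)"
    and "g \<in> range (\<lambda>t x. Elt t * x) \<union> range (\<lambda>t x. t)"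
  then consider s t where "f = (\<lambda>x. Elt s * x)" "g = (\<lambda>x. Elt t * x)"
    | s where "f = (\<lambda>x. s)" | t where "g = (\<lambda>x. t)"
    by blast
  then show "f \<circ> g \<in> range (\<lambda>t x. Elt t * x) \<union> range (\<lambda>t x. t)"
  proof cases
    case (1 s t)
    then have "f \<circ> g = (\<lambda>x. Elt (s * t) * x)"
      by (simp add: fun_eq_iff mult.assoc flip: times_adj.simps(1))
    then show ?thesis by blast
  qed (auto simp: comp_def)
qed

instance
  by standard (transfer, simp add: comp_assoc)

end

section \<open>The function \<open>\<tau>\<close>\<close>

definition blocks :: "'a set \<Rightarrow> 'a set \<Rightarrow> 'a list set" where
  "blocks A\<^sub>1 A\<^sub>2 = {w\<^sub>1 @ w\<^sub>2 | w\<^sub>1 w\<^sub>2. w\<^sub>1 \<in> words A\<^sub>1 \<and> w\<^sub>2 \<in> words A\<^sub>2}"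

definition sg_generated :: "'a list set \<Rightarrow> 'a list set" where
  "sg_generated B = concat ` words B"

text \<open>
  The set \<open>W \<rightarrow>\<^sub>E V\<close> consists of the functions from \<open>W\<close> to \<open>V\<close> with the fixed value \<open>undefined\<close>
  outside \<open>W\<close>; this makes a function on a set unique as an element of the HOL function type.
\<close>

definition block_hom ::
  "'a set \<Rightarrow> 'a set \<Rightarrow> ('a list \<Rightarrow> 't\<^sub>1) \<Rightarrow> ('a list \<Rightarrow> 't\<^sub>2) \<Rightarrow> 'a list \<Rightarrow> ('t\<^sub>1 \<times> 't\<^sub>2) list" where
  "block_hom A\<^sub>1 A\<^sub>2 \<psi>\<^sub>1 \<psi>\<^sub>2 =
    (THE \<mu>. \<mu> \<in> sg_generated (blocks A\<^sub>1 A\<^sub>2) \<rightarrow>\<^sub>E words UNIV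
       \<and> sg_hom_on (sg_generated (blocks A\<^sub>1 A\<^sub>2)) (@) \<mu>
       \<and> (\<forall>w\<^sub>1\<in>words A\<^sub>1. \<forall>w\<^sub>2\<in>words A\<^sub>2. \<mu> (w\<^sub>1 @ w\<^sub>2) = [(\<psi>\<^sub>1 w\<^sub>1, \<psi>\<^sub>2 w\<^sub>2)]))"

definition tau ::
  "'a set \<Rightarrow> 'a set \<Rightarrow> (('t\<^sub>1 \<times> 't\<^sub>2) list \<Rightarrow> 't\<^sub>0) \<Rightarrow> ('a list \<Rightarrow> 't\<^sub>1) \<Rightarrow> ('a list \<Rightarrow> 't\<^sub>2)
    \<Rightarrow> 'a list \<Rightarrow> 't\<^sub>2 adj \<times> 't\<^sub>0 adj \<times> 't\<^sub>1 adj" where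
  "tau A\<^sub>1 A\<^sub>2 \<chi> \<psi>\<^sub>1 \<psi>\<^sub>2 w =
    (let (v\<^sub>2, u, v\<^sub>1) = (THE (v\<^sub>2, u, v\<^sub>1). w = v\<^sub>2 @ u @ v\<^sub>1 \<and> v\<^sub>2 \<in> lists A\<^sub>2
            \<and> u \<in> insert [] (sg_generated (blocks A\<^sub>1 A\<^sub>2)) \<and> v\<^sub>1 \<in> lists A\<^sub>1);
         \<psi>\<^sub>0 = \<chi> \<circ> block_hom A\<^sub>1 A\<^sub>2 \<psi>\<^sub>1 \<psi>\<^sub>2
     in (ext_hom \<psi>\<^sub>2 v\<^sub>2, ext_hom \<psi>\<^sub>0 u, ext_hom \<psi>\<^sub>1 v\<^sub>1))"

section \<open>Triple products\<close>

locale triple_product = semigroup add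
  for add :: "'s \<Rightarrow> 's \<Rightarrow> 's" +
  fixes lact :: "'l::semigroup_mult \<Rightarrow> 's \<Rightarrow> 's"
    and ract :: "'s \<Rightarrow> 'r::semigroup_mult \<Rightarrow> 's"
  assumes lact_add: "lact l (add s s') = add (lact l s) (lact l s')"
    and lact_mult: "lact (l * l') s = lact l (lact l' s)"
    and ract_add: "ract (add s s') r = add (ract s r) (ract s' r)"
    and ract_mult: "ract s (r * r') = ract (ract s r) r'"
    and lact_ract: "ract (lact l s) r = lact l (ract s r)"
begin

definition triple_mult :: "'r \<times> 's \<times> 'l \<Rightarrow> 'r \<times> 's \<times> 'l \<Rightarrow> 'r \<times> 's \<times> 'l" where
  "triple_mult = (\<lambda>(r, s, l) (r', s', l'). (r * r', add (ract s r') (lact l s'), l * l'))"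

lemma semigroup_triple_mult: "semigroup triple_mult"
  by standard
    (auto simp: triple_mult_def lact_add ract_add lact_ract lact_mult ract_mult assoc mult.assoc)

end

section \<open>The merge semigroup and the merge decomposition\<close>

text \<open>
  The additively written semigroup \<open>S\<close> is the function type below, with the pointwise product \<open>(*)\<close> of
  \<^theory>\<open>HOL-Library.Function_Algebras\<close>.
\<close>

type_synonym ('t\<^sub>0, 't\<^sub>1, 't\<^sub>2) merge_fun = "'t\<^sub>1 adj \<times> 't\<^sub>2 adj \<Rightarrow> 't\<^sub>0 adj"

type_synonym ('t\<^sub>0, 't\<^sub>1, 't\<^sub>2) merge_sg = "'t\<^sub>2 flat \<times> ('t\<^sub>0, 't\<^sub>1, 't\<^sub>2) merge_fun \<times> 't\<^sub>1 sharp"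

definition merge_lact ::
  "'t\<^sub>1::semigroup_mult sharp \<Rightarrow> ('t\<^sub>0, 't\<^sub>1, 't\<^sub>2) merge_fun \<Rightarrow> ('t\<^sub>0, 't\<^sub>1, 't\<^sub>2) merge_fun" where
  "merge_lact s\<^sub>L s = (\<lambda>(t\<^sub>1, t\<^sub>2). s (sharp_app s\<^sub>L t\<^sub>1, t\<^sub>2))"

definition merge_ract ::
  "('t\<^sub>0, 't\<^sub>1, 't\<^sub>2) merge_fun \<Rightarrow> 't\<^sub>2::semigroup_mult flat \<Rightarrow> ('t\<^sub>0, 't\<^sub>1, 't\<^sub>2) merge_fun" where
  "merge_ract s s\<^sub>R = (\<lambda>(t\<^sub>1, t\<^sub>2). s (t\<^sub>1, flat_app s\<^sub>R t\<^sub>2))"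

interpretation merge: triple_product
  "(*) :: ('t\<^sub>0::semigroup_mult, 't\<^sub>1::semigroup_mult, 't\<^sub>2::semigroup_mult) merge_fun \<Rightarrow> _"
  merge_lact merge_ract
  by unfold_locales
    (auto simp: merge_lact_def merge_ract_def fun_eq_iff times_sharp.rep_eq times_flat.rep_eq
      mult.assoc)

abbreviation merge_mult ::
  "('t\<^sub>0::semigroup_mult, 't\<^sub>1::semigroup_mult, 't\<^sub>2::semigroup_mult) merge_sg
    \<Rightarrow> ('t\<^sub>0, 't\<^sub>1, 't\<^sub>2) merge_sg \<Rightarrow> ('t\<^sub>0, 't\<^sub>1, 't\<^sub>2) merge_sg" where
  "merge_mult \<equiv> merge.triple_mult"

text \<open>
  In the second clause, \<open>t\<^sub>1 * Elt (\<psi>\<^sub>1 w\<^sub>1)\<close> always has the form \<open>Elt _\<close>, because \<open>T\<^sub>1\<close> is an ideal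
  of \<open>T\<^sub>1\<^sup>I\<close>.
\<close>

fun merge_s ::
  "(('t\<^sub>1::semigroup_mult \<times> 't\<^sub>2) list \<Rightarrow> 't\<^sub>0) \<Rightarrow> ('a list \<Rightarrow> 't\<^sub>1) \<Rightarrow> 'a list
    \<Rightarrow> ('t\<^sub>0, 't\<^sub>1, 't\<^sub>2) merge_fun" where
  "merge_s \<chi> \<psi>\<^sub>1 w\<^sub>1 (t\<^sub>1, Adj) = Adj"
| "merge_s \<chi> \<psi>\<^sub>1 w\<^sub>1 (t\<^sub>1, Elt t\<^sub>2) = Elt (\<chi> [(the_elt (t\<^sub>1 * Elt (\<psi>\<^sub>1 w\<^sub>1)), t\<^sub>2)])"

definition merge_decomposition ::
  "'a set \<Rightarrow> 'a set \<Rightarrow> (('t\<^sub>1::semigroup_mult \<times> 't\<^sub>2::semigroup_mult) list \<Rightarrow> 't\<^sub>0::semigroup_mult)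
    \<Rightarrow> ('a list \<Rightarrow> 't\<^sub>1) \<Rightarrow> ('a list \<Rightarrow> 't\<^sub>2) \<Rightarrow> 'a list \<Rightarrow> ('t\<^sub>0, 't\<^sub>1, 't\<^sub>2) merge_sg" where
  "merge_decomposition A\<^sub>1 A\<^sub>2 \<chi> \<psi>\<^sub>1 \<psi>\<^sub>2 =
    (THE h. h \<in> words (A\<^sub>1 \<union> A\<^sub>2) \<rightarrow>\<^sub>E UNIV \<and> sg_hom_on (words (A\<^sub>1 \<union> A\<^sub>2)) merge_mult h
       \<and> (\<forall>a\<in>A\<^sub>1. h [a] = (flat_const Adj, merge_s \<chi> \<psi>\<^sub>1 [a], sharp_mul (\<psi>\<^sub>1 [a])))
       \<and> (\<forall>a\<in>A\<^sub>2. h [a] = (flat_mul (\<psi>\<^sub>2 [a]), \<lambda>_. Adj, sharp_const Adj)))"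

section \<open>The definite descriptions above are well defined\<close>

lemma words_iff [simp]: "w \<in> words A \<longleftrightarrow> w \<noteq> [] \<and> set w \<subseteq> A"
  by (auto simp: words_def in_lists_conv_set)

lemma free_hom_ex1:
  fixes f :: "'m \<Rightarrow> 'm \<Rightarrow> 'm"
  assumes "semigroup f"
  shows "\<exists>!h. h \<in> words A \<rightarrow>\<^sub>E UNIV \<and> sg_hom_on (words A) f h \<and> (\<forall>a\<in>A. h [a] = g a)"
proof -
  interpret semigroup f by fact
  define k where "k = rec_list undefined (\<lambda>a w r. if w = [] then g a else f (g a) r)"
  have k1: "k [a] = g a" for a
    by (simp add: k_def)
  have k2: "k (a # w) = f (g a) (k w)" if "w \<noteq> []" for a w
    using that by (simp add: k_def)
  have kapp: "k (u @ v) = f (k u) (k v)" if "u \<noteq> []" "v \<noteq> []" for u v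
    using that(1)
  proof (induction u)
    case (Cons a u)
    then show ?case
      using that(2) by (cases "u = []") (simp_all add: k1 k2 assoc)
  qed simp
  show ?thesis
  proof (rule ex1I)
    show "restrict k (words A) \<in> words A \<rightarrow>\<^sub>E UNIV
        \<and> sg_hom_on (words A) f (restrict k (words A)) \<and> (\<forall>a\<in>A. restrict k (words A) [a] = g a)"
      by (auto simp: sg_hom_on_def kapp k1)
  next
    fix h
    assume h: "h \<in> words A \<rightarrow>\<^sub>E UNIV \<and> sg_hom_on (words A) f h \<and> (\<forall>a\<in>A. h [a] = g a)"
    have "h w = k w" if "w \<noteq> []" "set w \<subseteq> A" for w
      using that
    proof (induction w)
      case (Cons a w)
      show ?case
      proof (cases "w = []")
        case True
        then show ?thesis using Cons.prems h by (simp add: k1)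
      next
        case False
        then have "h ([a] @ w) = f (h [a]) (h w)"
          using h Cons.prems unfolding sg_hom_on_def by (metis (no_types, lifting) words_iff
              list.distinct(1) set_append append_Cons append_Nil le_sup_iff)
        then show ?thesis using Cons False h by (simp add: k2)
      qed
    qed simp
    moreover have "h w = undefined" if "w \<notin> words A" for w
      using h that by (meson PiE_arb)
    ultimately show "h = restrict k (words A)"
      by (auto simp: fun_eq_iff)
  qed
qed

lemma merge_decomposition_ex1:
  fixes \<chi> :: "('t\<^sub>1::semigroup_mult \<times> 't\<^sub>2::semigroup_mult) list \<Rightarrow> 't\<^sub>0::semigroup_mult"
  assumes "A\<^sub>1 \<inter> A\<^sub>2 = {}"
  shows "\<exists>!h. h \<in> words (A\<^sub>1 \<union> A\<^sub>2) \<rightarrow>\<^sub>E UNIV \<and> sg_hom_on (words (A\<^sub>1 \<union> A\<^sub>2)) merge_mult h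
       \<and> (\<forall>a\<in>A\<^sub>1. h [a] = (flat_const Adj, merge_s \<chi> \<psi>\<^sub>1 [a], sharp_mul (\<psi>\<^sub>1 [a])))
       \<and> (\<forall>a\<in>A\<^sub>2. h [a] = (flat_mul (\<psi>\<^sub>2 [a]), \<lambda>_. Adj, sharp_const Adj))"
proof -
  let ?g = "\<lambda>a. if a \<in> A\<^sub>1 then (flat_const Adj, merge_s \<chi> \<psi>\<^sub>1 [a], sharp_mul (\<psi>\<^sub>1 [a]))
    else (flat_mul (\<psi>\<^sub>2 [a]), \<lambda>_. Adj, sharp_const Adj)"
  have "(\<forall>a\<in>A\<^sub>1 \<union> A\<^sub>2. h [a] = ?g a) \<longleftrightarrow>
      (\<forall>a\<in>A\<^sub>1. h [a] = (flat_const Adj, merge_s \<chi> \<psi>\<^sub>1 [a], sharp_mul (\<psi>\<^sub>1 [a])))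
       \<and> (\<forall>a\<in>A\<^sub>2. h [a] = (flat_mul (\<psi>\<^sub>2 [a]), \<lambda>_. Adj, sharp_const Adj))" for h
    using assms by auto
  then show ?thesis
    using free_hom_ex1[OF merge.semigroup_triple_mult, of "A\<^sub>1 \<union> A\<^sub>2" ?g] by presburger
qed

lemma takeWhile_split:
  assumes "x @ r = x' @ r'" "\<forall>a\<in>set x \<union> set x'. P a"
    "r = [] \<or> \<not> P (hd r)" "r' = [] \<or> \<not> P (hd r')"
  shows "x = x' \<and> r = r'"
proof -
  have *: "takeWhile P (y @ s) = y" if "\<forall>a\<in>set y. P a" "s = [] \<or> \<not> P (hd s)" for y s
    using that by (cases s) (auto simp: takeWhile_append)
  have "x = x'"
    using *[of x r] *[of x' r'] assms by auto
  then show ?thesis using assms by simp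
qed

abbreviation join :: "('a list \<times> 'a list) list \<Rightarrow> 'a list" where
  "join ps \<equiv> concat (map (\<lambda>(x, y). x @ y) ps)"

lemma join_hd:
  assumes "ps \<in> lists (words A\<^sub>1 \<times> words A\<^sub>2)" "ps \<noteq> []"
  shows "join ps \<noteq> [] \<and> hd (join ps) \<in> A\<^sub>1 \<and> last (join ps) \<in> A\<^sub>2"
proof -
  obtain x y qs where ps: "ps = (x, y) # qs"
    using assms(2) by (cases ps) auto
  obtain x' y' rs where ps': "ps = rs @ [(x', y')]"
    using assms(2) by (cases ps rule: rev_cases) auto
  have "(x, y) \<in> words A\<^sub>1 \<times> words A\<^sub>2" "(x', y') \<in> words A\<^sub>1 \<times> words A\<^sub>2"
    using assms(1) ps ps' by (metis Cons_in_lists_iff, metis Cons_in_lists_iff append_in_lists_conv)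
  then have "x \<noteq> []" "set x \<subseteq> A\<^sub>1" "y' \<noteq> []" "set y' \<subseteq> A\<^sub>2"
    by simp_all
  then have "hd x \<in> A\<^sub>1" "last y' \<in> A\<^sub>2"
    using hd_in_set last_in_set by blast+
  with \<open>x \<noteq> []\<close> \<open>y' \<noteq> []\<close> have "hd (join ps) \<in> A\<^sub>1" "join ps \<noteq> []" "last (join (rs @ [(x', y')])) \<in> A\<^sub>2"
    by (simp_all add: ps)
  then show ?thesis by (metis ps')
qed

lemma join_inject:
  assumes "A\<^sub>1 \<inter> A\<^sub>2 = {}"
  shows "\<lbrakk>ps \<in> lists (words A\<^sub>1 \<times> words A\<^sub>2); qs \<in> lists (words A\<^sub>1 \<times> words A\<^sub>2); join ps = join qs\<rbrakk>
    \<Longrightarrow> ps = qs"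
proof (induction ps arbitrary: qs)
  case Nil
  then show ?case using join_hd[of qs] by fastforce
next
  case (Cons p ps)
  obtain x y where p: "p = (x, y)" by fastforce
  have "qs \<noteq> []" using Cons.prems join_hd[of "p # ps"] by fastforce
  then obtain x' y' qs' where qs: "qs = (x', y') # qs'" by (cases qs) auto
  have xy: "set x \<subseteq> A\<^sub>1" "set y \<subseteq> A\<^sub>2" "set x' \<subseteq> A\<^sub>1" "set y' \<subseteq> A\<^sub>2" "y \<noteq> []" "y' \<noteq> []"
    using Cons.prems by (auto simp: p qs)
  have ls: "ps \<in> lists (words A\<^sub>1 \<times> words A\<^sub>2)" "qs' \<in> lists (words A\<^sub>1 \<times> words A\<^sub>2)"
    using Cons.prems by (auto simp: p qs)
  have hds: "hd y \<in> A\<^sub>2" "hd y' \<in> A\<^sub>2"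
    using xy hd_in_set by blast+
  have "x @ (y @ join ps) = x' @ (y' @ join qs')"
    using Cons.prems(3) by (simp add: p qs)
  then have "x = x' \<and> y @ join ps = y' @ join qs'"
    by (rule takeWhile_split[where P = "\<lambda>a. a \<in> A\<^sub>1"]) (use xy hds assms in auto)
  moreover have "y = y' \<and> join ps = join qs'" if "y @ join ps = y' @ join qs'"
    using that
    by (rule takeWhile_split[where P = "\<lambda>a. a \<in> A\<^sub>2"])
      (use xy join_hd[OF ls(1)] join_hd[OF ls(2)] assms in fastforce)+
  ultimately show ?case using Cons.IH ls by (auto simp: p qs)
qed

lemma sg_generated_blocks:
  "sg_generated (blocks A\<^sub>1 A\<^sub>2) = join ` (lists (words A\<^sub>1 \<times> words A\<^sub>2) - {[]})"
proof -
  have "blocks A\<^sub>1 A\<^sub>2 = (\<lambda>(x, y). x @ y) ` (words A\<^sub>1 \<times> words A\<^sub>2)"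
    by (force simp: blocks_def)
  then have "words (blocks A\<^sub>1 A\<^sub>2) = map (\<lambda>(x, y). x @ y) ` (lists (words A\<^sub>1 \<times> words A\<^sub>2) - {[]})"
    unfolding words_def[of "blocks _ _"] by (auto simp: lists_image simp del: words_iff)
  then show ?thesis
    by (simp add: sg_generated_def image_image)
qed

lemma block_hom_ex1:
  assumes "A\<^sub>1 \<inter> A\<^sub>2 = {}"
  shows "\<exists>!\<mu>. \<mu> \<in> sg_generated (blocks A\<^sub>1 A\<^sub>2) \<rightarrow>\<^sub>E words UNIV
       \<and> sg_hom_on (sg_generated (blocks A\<^sub>1 A\<^sub>2)) (@) \<mu>
       \<and> (\<forall>w\<^sub>1\<in>words A\<^sub>1. \<forall>w\<^sub>2\<in>words A\<^sub>2. \<mu> (w\<^sub>1 @ w\<^sub>2) = [(\<psi>\<^sub>1 w\<^sub>1, \<psi>\<^sub>2 w\<^sub>2)])"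
proof -
  let ?L = "lists (words A\<^sub>1 \<times> words A\<^sub>2)"
  let ?W = "sg_generated (blocks A\<^sub>1 A\<^sub>2)"
  define m where "m = restrict (\<lambda>u. map (\<lambda>(x, y). (\<psi>\<^sub>1 x, \<psi>\<^sub>2 y)) (the_inv_into ?L join u)) ?W"
  have inj: "inj_on join ?L"
    using join_inject[OF assms] by (intro inj_onI) blast
  have W: "join ps \<in> ?W" if "ps \<in> ?L" "ps \<noteq> []" for ps
    using that by (auto simp: sg_generated_blocks)
  have m: "m (join ps) = map (\<lambda>(x, y). (\<psi>\<^sub>1 x, \<psi>\<^sub>2 y)) ps" if "ps \<in> ?L" "ps \<noteq> []" for ps
    unfolding m_def using W[OF that] the_inv_into_f_f[OF inj that(1)] by simp
  show ?thesis
  proof (rule ex1I[of _ m], intro conjI ballI)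
    have "m u \<noteq> []" if u: "u \<in> ?W" for u
    proof -
      obtain ps where "ps \<in> ?L" "ps \<noteq> []" "u = join ps"
        using u by (auto simp only: sg_generated_blocks)
      then show ?thesis using m[of ps] by (simp only: map_is_Nil_conv) simp
    qed
    moreover have "m u = undefined" if "u \<notin> ?W" for u
      using that by (simp add: m_def)
    ultimately show "m \<in> ?W \<rightarrow>\<^sub>E words UNIV"
      by (intro PiE_I) simp_all
    have "m (join ps @ join qs) = m (join ps) @ m (join qs)"
      if "ps \<in> ?L" "ps \<noteq> []" "qs \<in> ?L" "qs \<noteq> []" for ps qs
      using m[of "ps @ qs"] that by (simp add: m)
    then show "sg_hom_on ?W (@) m"
      by (auto simp only: sg_hom_on_def sg_generated_blocks)
    show "m (x @ y) = [(\<psi>\<^sub>1 x, \<psi>\<^sub>2 y)]" if "x \<in> words A\<^sub>1" "y \<in> words A\<^sub>2" for x y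
      using m[of "[(x, y)]"] that by simp
  next
    fix h
    assume h: "h \<in> ?W \<rightarrow>\<^sub>E words UNIV \<and> sg_hom_on ?W (@) h
       \<and> (\<forall>w\<^sub>1\<in>words A\<^sub>1. \<forall>w\<^sub>2\<in>words A\<^sub>2. h (w\<^sub>1 @ w\<^sub>2) = [(\<psi>\<^sub>1 w\<^sub>1, \<psi>\<^sub>2 w\<^sub>2)])"
    have "h (join ps) = map (\<lambda>(x, y). (\<psi>\<^sub>1 x, \<psi>\<^sub>2 y)) ps" if "ps \<in> ?L" "ps \<noteq> []" for ps
      using that
    proof (induction ps rule: list.induct)
      case (Cons p ps)
      obtain x y where p: "p = (x, y)" by fastforce
      have xy: "x \<in> words A\<^sub>1" "y \<in> words A\<^sub>2" and ps: "ps \<in> ?L"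
        using Cons.prems by (auto simp: p)
      have hxy: "h (x @ y) = [(\<psi>\<^sub>1 x, \<psi>\<^sub>2 y)]"
        using h xy by blast
      show ?case
      proof (cases "ps = []")
        case True
        then show ?thesis using hxy by (simp add: p)
      next
        case False
        have "x @ y \<in> ?W"
          using W[of "[(x, y)]"] xy by simp
        then have "h ((x @ y) @ join ps) = h (x @ y) @ h (join ps)"
          using h W[OF ps False] unfolding sg_hom_on_def by blast
        then show ?thesis using hxy Cons.IH[OF ps False] by (simp add: p)
      qed
    qed simp
    then have "h (join ps) = m (join ps)" if "ps \<in> ?L" "ps \<noteq> []" for ps
      using that m by presburger
    then have "h u = m u" if "u \<in> ?W" for u
      using that by (auto simp only: sg_generated_blocks)
    moreover have "h u = m u" if "u \<notin> ?W" for u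
      using PiE_arb[OF conjunct1[OF h] that] that by (simp add: m_def)
    ultimately show "h = m"
      by (intro ext) blast
  qed
qed

lemma tau_factorization_ex1:
  assumes "A\<^sub>1 \<inter> A\<^sub>2 = {}" and "w \<in> lists (A\<^sub>1 \<union> A\<^sub>2)"
  shows "\<exists>!(v\<^sub>2, u, v\<^sub>1). w = v\<^sub>2 @ u @ v\<^sub>1 \<and> v\<^sub>2 \<in> lists A\<^sub>2
            \<and> u \<in> insert [] (sg_generated (blocks A\<^sub>1 A\<^sub>2)) \<and> v\<^sub>1 \<in> lists A\<^sub>1"
proof -
  let ?L = "lists (words A\<^sub>1 \<times> words A\<^sub>2)"
  have star: "insert [] (sg_generated (blocks A\<^sub>1 A\<^sub>2)) = join ` ?L"
  proof -
    have "?L = insert [] (?L - {[]})"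
      by (rule insert_Diff[symmetric]) simp
    from arg_cong[OF this, of "image join"]
    have "join ` ?L = insert (join []) (join ` (?L - {[]}))"
      unfolding image_insert .
    then show ?thesis
      by (simp only: sg_generated_blocks list.map concat.simps)
  qed
  have ex: "\<exists>v\<^sub>2 ps v\<^sub>1. w = v\<^sub>2 @ join ps @ v\<^sub>1 \<and> set v\<^sub>2 \<subseteq> A\<^sub>2 \<and> ps \<in> ?L \<and> set v\<^sub>1 \<subseteq> A\<^sub>1"
    using assms(2)
  proof (induction w)
    case Nil
    then show ?case by (intro exI[of _ "[]"]) auto
  next
    case (Cons a w)
    then obtain v\<^sub>2 ps v\<^sub>1 where w: "w = v\<^sub>2 @ join ps @ v\<^sub>1" "set v\<^sub>2 \<subseteq> A\<^sub>2" "ps \<in> ?L" "set v\<^sub>1 \<subseteq> A\<^sub>1"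
      by blast
    consider "a \<in> A\<^sub>2" | "a \<in> A\<^sub>1" "v\<^sub>2 \<noteq> []" | "a \<in> A\<^sub>1" "v\<^sub>2 = []" "ps = []"
      | x y qs where "a \<in> A\<^sub>1" "v\<^sub>2 = []" "ps = (x, y) # qs"
      using Cons.hyps by (cases ps) auto
    then show ?case
    proof cases
      case 1
      then show ?thesis using w by (intro exI[of _ "a # v\<^sub>2"] exI[of _ ps] exI[of _ v\<^sub>1]) simp
    next
      case 2
      then show ?thesis using w
        by (intro exI[of _ "[]"] exI[of _ "([a], v\<^sub>2) # ps"] exI[of _ v\<^sub>1]) simp
    next
      case 3
      then show ?thesis using w
        by (intro exI[of _ "[]"] exI[of _ "[]"] exI[of _ "a # v\<^sub>1"]) simp
    next
      case 4
      then show ?thesis using w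
        by (intro exI[of _ "[]"] exI[of _ "(a # x, y) # qs"] exI[of _ v\<^sub>1]) simp
    qed
  qed
  have uniq: "v\<^sub>2 = v\<^sub>2' \<and> join ps = join ps' \<and> v\<^sub>1 = v\<^sub>1'"
    if eq: "v\<^sub>2 @ join ps @ v\<^sub>1 = v\<^sub>2' @ join ps' @ v\<^sub>1'"
      and v2: "set v\<^sub>2 \<subseteq> A\<^sub>2" "set v\<^sub>2' \<subseteq> A\<^sub>2" and v1: "set v\<^sub>1 \<subseteq> A\<^sub>1" "set v\<^sub>1' \<subseteq> A\<^sub>1"
      and ps: "ps \<in> ?L" "ps' \<in> ?L"
    for v\<^sub>2 v\<^sub>2' v\<^sub>1 v\<^sub>1' ps ps'
  proof -
    have hd: "join qs @ v = [] \<or> hd (join qs @ v) \<notin> A\<^sub>2" if "qs \<in> ?L" "set v \<subseteq> A\<^sub>1" for qs v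
    proof -
      have "hd v \<in> A\<^sub>1" if "v \<noteq> []"
        using hd_in_set[OF that] \<open>set v \<subseteq> A\<^sub>1\<close> by blast
      then show ?thesis
        using join_hd[OF that(1)] assms(1) by (cases "qs = []") (auto simp: hd_append)
    qed
    have last: "rev (join qs) = [] \<or> hd (rev (join qs)) \<notin> A\<^sub>1" if "qs \<in> ?L" for qs
      using join_hd[OF that] assms(1) by (cases "qs = []") (auto simp: hd_rev)
    have 1: "v\<^sub>2 = v\<^sub>2' \<and> join ps @ v\<^sub>1 = join ps' @ v\<^sub>1'"
      using eq by (rule takeWhile_split[where P = "\<lambda>a. a \<in> A\<^sub>2"]) (use v2 hd[OF ps(1) v1(1)] hd[OF ps(2) v1(2)] in blast)+
    then have "rev (join ps @ v\<^sub>1) = rev (join ps' @ v\<^sub>1')"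
      by simp
    then have "rev v\<^sub>1 @ rev (join ps) = rev v\<^sub>1' @ rev (join ps')"
      by (simp only: rev_append)
    then have "rev v\<^sub>1 = rev v\<^sub>1' \<and> rev (join ps) = rev (join ps')"
      by (rule takeWhile_split[where P = "\<lambda>a. a \<in> A\<^sub>1"]) (use v1 last[OF ps(1)] last[OF ps(2)] in \<open>simp only: set_rev; blast\<close>)+
    with 1 show ?thesis by (simp only: rev_is_rev_conv)
  qed
  obtain v\<^sub>2 ps v\<^sub>1 where w: "w = v\<^sub>2 @ join ps @ v\<^sub>1" "set v\<^sub>2 \<subseteq> A\<^sub>2" "ps \<in> ?L" "set v\<^sub>1 \<subseteq> A\<^sub>1"
    using ex by blast
  show ?thesis
    unfolding star
  proof (rule ex1I[of _ "(v\<^sub>2, join ps, v\<^sub>1)"])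
    show "case (v\<^sub>2, join ps, v\<^sub>1) of (v\<^sub>2, u, v\<^sub>1) \<Rightarrow>
        w = v\<^sub>2 @ u @ v\<^sub>1 \<and> v\<^sub>2 \<in> lists A\<^sub>2 \<and> u \<in> join ` ?L \<and> v\<^sub>1 \<in> lists A\<^sub>1"
      using w by (auto simp: in_lists_conv_set)
  next
    fix t
    assume "case t of (v\<^sub>2, u, v\<^sub>1) \<Rightarrow>
        w = v\<^sub>2 @ u @ v\<^sub>1 \<and> v\<^sub>2 \<in> lists A\<^sub>2 \<and> u \<in> join ` ?L \<and> v\<^sub>1 \<in> lists A\<^sub>1"
    then obtain v\<^sub>2' ps' v\<^sub>1' where t: "t = (v\<^sub>2', join ps', v\<^sub>1')" "w = v\<^sub>2' @ join ps' @ v\<^sub>1'"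
      "set v\<^sub>2' \<subseteq> A\<^sub>2" "ps' \<in> ?L" "set v\<^sub>1' \<subseteq> A\<^sub>1"
      by (cases t) (auto simp only: prod.case lists_eq_set mem_Collect_eq)
    show "t = (v\<^sub>2, join ps, v\<^sub>1)"
      using uniq[OF trans[OF w(1)[symmetric] t(2)] w(2) t(3) w(4) t(5) w(3) t(4)] t(1)
      by (simp only: simp_thms)
  qed
qed

end

theory Submission
  imports Defs
begin

text \<open>
  The function is evaluation of the triple at the adjoined identities,
  \<open>f (s\<^sub>R, s, s\<^sub>L) = (s\<^sub>R I\<^sub>2, s (I\<^sub>1, I\<^sub>2), I\<^sub>1 s\<^sub>L)\<close>.

  The middle component \<open>s\<close> of \<open>\<psi>\<^sub>M w\<close>, evaluated at \<open>(t\<^sub>1, t\<^sub>2)\<close>, is the contribution of \<open>w\<close> to the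
  \<open>T\<^sub>0\<close>-value of a longer word, read in a context: \<open>t\<^sub>1\<close> is the value of the run of \<open>A\<^sub>1\<close>-letters
  directly before \<open>w\<close>, and \<open>t\<^sub>2\<close> is the value of the run of \<open>A\<^sub>2\<close>-letters directly after it. The
  value \<open>\<chi> [(\<psi>\<^sub>1 x, \<psi>\<^sub>2 y)]\<close> of a block \<open>xy\<close> is contributed by the last letter of its \<open>A\<^sub>1\<close>-run \<open>x\<close>,
  so letters of \<open>A\<^sub>2\<close> contribute \<open>I\<^sub>0\<close> themselves. The outer components update the contexts: a
  letter of \<open>A\<^sub>1\<close> extends the left context of what follows it and resets the right context of what
  precedes it to \<open>I\<^sub>2\<close>; dually, a letter of \<open>A\<^sub>2\<close> extends the right context and resets the left one.

  Hence in a block \<open>xy\<close> the run \<open>x\<close> sees \<open>\<psi>\<^sub>2 y\<close> (lemma \<open>mid_block\<close>), and distinct blocks do not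
  interact, since every block resets both contexts (lemma \<open>mid_join\<close>). In the factorization
  \<open>w = v\<^sub>2 u v\<^sub>1\<close> the outer runs contribute \<open>I\<^sub>0\<close> to the middle component at \<open>(I\<^sub>1, I\<^sub>2)\<close>: \<open>v\<^sub>2\<close> because it
  is an \<open>A\<^sub>2\<close>-run, and \<open>v\<^sub>1\<close> because no \<open>A\<^sub>2\<close>-run follows it. What remains of the outer components
  at \<open>I\<^sub>2\<close> and \<open>I\<^sub>1\<close> is \<open>\<psi>\<^sub>2 v\<^sub>2\<close> and \<open>\<psi>\<^sub>1 v\<^sub>1\<close>, since \<open>u\<close> resets both contexts.
\<close>

section \<open>Extending homomorphisms to the empty word\<close>

lemma mult_Adj [simp]: "x * Adj = x" for x :: "'t::semigroup_mult adj"
  using mult_1_right[of x] by (simp only: one_adj_def)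

lemma ext_hom_trivial [simp]: "ext_hom \<psi> [] = Adj" "ext_hom \<psi> [a] = Elt (\<psi> [a])"
  by (simp_all add: ext_hom_def)

lemma ext_hom_append:
  assumes "sg_hom_on (words B) (*) \<psi>" and "set u \<subseteq> B" and "set v \<subseteq> B"
  shows "ext_hom \<psi> (u @ v) = ext_hom \<psi> u * ext_hom \<psi> v"
  using assms by (simp add: ext_hom_def sg_hom_on_def)

lemma ext_hom_Cons:
  assumes "sg_hom_on (words B) (*) \<psi>" and "a \<in> B" and "set v \<subseteq> B"
  shows "ext_hom \<psi> (a # v) = Elt (\<psi> [a]) * ext_hom \<psi> v"
  using ext_hom_append[OF assms(1), of "[a]" v] assms(2,3) by simp

lemma block_hom_join:
  assumes "A\<^sub>1 \<inter> A\<^sub>2 = {}" and "ps \<in> lists (words A\<^sub>1 \<times> words A\<^sub>2)" and "ps \<noteq> []"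
  shows "block_hom A\<^sub>1 A\<^sub>2 \<psi>\<^sub>1 \<psi>\<^sub>2 (join ps) = map (\<lambda>(x, y). (\<psi>\<^sub>1 x, \<psi>\<^sub>2 y)) ps"
  using assms(2,3)
proof (induction ps rule: list.induct)
  case (Cons p ps)
  let ?L = "lists (words A\<^sub>1 \<times> words A\<^sub>2)"
  let ?W = "sg_generated (blocks A\<^sub>1 A\<^sub>2)"
  let ?\<mu> = "block_hom A\<^sub>1 A\<^sub>2 \<psi>\<^sub>1 \<psi>\<^sub>2"
  have hom: "sg_hom_on ?W (@) ?\<mu>"
    and block: "\<And>x y. x \<in> words A\<^sub>1 \<Longrightarrow> y \<in> words A\<^sub>2 \<Longrightarrow> ?\<mu> (x @ y) = [(\<psi>\<^sub>1 x, \<psi>\<^sub>2 y)]"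
    using theI'[OF block_hom_ex1[OF assms(1), of \<psi>\<^sub>1 \<psi>\<^sub>2]] unfolding block_hom_def by blast+
  have W: "join qs \<in> ?W" if "qs \<in> ?L" "qs \<noteq> []" for qs
    using that by (auto simp: sg_generated_blocks)
  obtain x y where p: "p = (x, y)" by fastforce
  have xy: "x \<in> words A\<^sub>1" "y \<in> words A\<^sub>2" and ps: "ps \<in> ?L"
    using Cons.prems by (auto simp: p)
  show ?case
  proof (cases "ps = []")
    case True
    then show ?thesis using block[OF xy] by (simp add: p)
  next
    case False
    have "x @ y \<in> ?W"
      using W[of "[(x, y)]"] xy by simp
    then have "?\<mu> ((x @ y) @ join ps) = ?\<mu> (x @ y) @ ?\<mu> (join ps)"
      using hom W[OF ps False] unfolding sg_hom_on_def by blast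
    then show ?thesis using block[OF xy] Cons.IH[OF ps False] by (simp add: p)
  qed
qed simp

section \<open>The components of the merge decomposition\<close>

locale merge_data =
  fixes A\<^sub>1 A\<^sub>2 :: "'a set"
    and \<psi>\<^sub>1 :: "'a list \<Rightarrow> 't\<^sub>1::semigroup_mult"
    and \<psi>\<^sub>2 :: "'a list \<Rightarrow> 't\<^sub>2::semigroup_mult"
    and \<chi> :: "('t\<^sub>1 \<times> 't\<^sub>2) list \<Rightarrow> 't\<^sub>0::semigroup_mult"
  assumes disjoint: "A\<^sub>1 \<inter> A\<^sub>2 = {}"
    and hom_1: "sg_hom_on (words A\<^sub>1) (*) \<psi>\<^sub>1"
    and hom_2: "sg_hom_on (words A\<^sub>2) (*) \<psi>\<^sub>2"
    and hom_chi: "sg_hom_on (words UNIV) (*) \<chi>"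
begin

abbreviation h :: "'a list \<Rightarrow> ('t\<^sub>0, 't\<^sub>1, 't\<^sub>2) merge_sg" where
  "h \<equiv> merge_decomposition A\<^sub>1 A\<^sub>2 \<chi> \<psi>\<^sub>1 \<psi>\<^sub>2"

lemmas h_spec = theI'[OF merge_decomposition_ex1[OF disjoint, of \<chi> \<psi>\<^sub>1 \<psi>\<^sub>2],
    folded merge_decomposition_def]

lemma h_append:
  assumes "u \<in> words (A\<^sub>1 \<union> A\<^sub>2)" and "v \<in> words (A\<^sub>1 \<union> A\<^sub>2)"
  shows "h (u @ v) = merge_mult (h u) (h v)"
  using h_spec[THEN conjunct2, THEN conjunct1, unfolded sg_hom_on_def, THEN bspec, THEN bspec, OF assms] .

lemma h_letter_1:
  "a \<in> A\<^sub>1 \<Longrightarrow> h [a] = (flat_const Adj, merge_s \<chi> \<psi>\<^sub>1 [a], sharp_mul (\<psi>\<^sub>1 [a]))"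
  using h_spec[THEN conjunct2, THEN conjunct2, THEN conjunct1, THEN bspec] .

lemma h_letter_2: "a \<in> A\<^sub>2 \<Longrightarrow> h [a] = (flat_mul (\<psi>\<^sub>2 [a]), \<lambda>_. Adj, sharp_const Adj)"
  using h_spec[THEN conjunct2, THEN conjunct2, THEN conjunct2, THEN bspec] .

text \<open>
  The merge semigroup has no identity to serve as the value of the empty word, but the components
  of a triple are used only as functions, and for those the right values on the empty word are the
  identity map and the constant \<open>I\<^sub>0\<close>. With them the product rules below hold for all words,
  so that empty factors of \<open>v\<^sub>2 u v\<^sub>1\<close> need no case distinctions.
\<close>

definition rctx :: "'a list \<Rightarrow> 't\<^sub>2 adj \<Rightarrow> 't\<^sub>2 adj" where
  "rctx w = (if w = [] then id else flat_app (fst (h w)))"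

definition mid :: "'a list \<Rightarrow> 't\<^sub>1 adj \<Rightarrow> 't\<^sub>2 adj \<Rightarrow> 't\<^sub>0 adj" where
  "mid w t\<^sub>1 t\<^sub>2 = (if w = [] then Adj else fst (snd (h w)) (t\<^sub>1, t\<^sub>2))"

definition lctx :: "'a list \<Rightarrow> 't\<^sub>1 adj \<Rightarrow> 't\<^sub>1 adj" where
  "lctx w = (if w = [] then id else sharp_app (snd (snd (h w))))"

lemma ctx_Nil [simp]: "rctx [] t\<^sub>2 = t\<^sub>2" "mid [] t\<^sub>1 t\<^sub>2 = Adj" "lctx [] t\<^sub>1 = t\<^sub>1"
  by (simp_all add: rctx_def mid_def lctx_def)

lemma ctx_append:
  assumes "set u \<subseteq> A\<^sub>1 \<union> A\<^sub>2" and "set v \<subseteq> A\<^sub>1 \<union> A\<^sub>2"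
  shows rctx_append: "rctx (u @ v) t\<^sub>2 = rctx u (rctx v t\<^sub>2)"
    and mid_append: "mid (u @ v) t\<^sub>1 t\<^sub>2 = mid u t\<^sub>1 (rctx v t\<^sub>2) * mid v (lctx u t\<^sub>1) t\<^sub>2"
    and lctx_append: "lctx (u @ v) t\<^sub>1 = lctx v (lctx u t\<^sub>1)"
proof -
  have "h (u @ v) = merge_mult (h u) (h v)" if "u \<noteq> []" "v \<noteq> []"
    using h_append that assms by simp
  then show "rctx (u @ v) t\<^sub>2 = rctx u (rctx v t\<^sub>2)"
    and "mid (u @ v) t\<^sub>1 t\<^sub>2 = mid u t\<^sub>1 (rctx v t\<^sub>2) * mid v (lctx u t\<^sub>1) t\<^sub>2"
    and "lctx (u @ v) t\<^sub>1 = lctx v (lctx u t\<^sub>1)"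
    by (cases "u = []"; cases "v = []"; cases "h u"; cases "h v";
        simp add: rctx_def mid_def lctx_def merge.triple_mult_def merge_ract_def merge_lact_def
          times_flat.rep_eq times_sharp.rep_eq)+
qed

lemma ctx_letter_1:
  assumes "a \<in> A\<^sub>1"
  shows "rctx [a] t\<^sub>2 = Adj" "mid [a] t\<^sub>1 t\<^sub>2 = merge_s \<chi> \<psi>\<^sub>1 [a] (t\<^sub>1, t\<^sub>2)"
    "lctx [a] t\<^sub>1 = t\<^sub>1 * Elt (\<psi>\<^sub>1 [a])"
  using h_letter_1[OF assms]
  by (simp_all add: rctx_def mid_def lctx_def flat_const.rep_eq sharp_mul.rep_eq)

lemma ctx_letter_2:
  assumes "a \<in> A\<^sub>2"
  shows "rctx [a] t\<^sub>2 = Elt (\<psi>\<^sub>2 [a]) * t\<^sub>2" "mid [a] t\<^sub>1 t\<^sub>2 = Adj" "lctx [a] t\<^sub>1 = Adj"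
  using h_letter_2[OF assms]
  by (simp_all add: rctx_def mid_def lctx_def flat_mul.rep_eq sharp_const.rep_eq)

section \<open>Runs over one subalphabet\<close>

text \<open>
  Of the letters of an \<open>A\<^sub>1\<close>-run only the last one meets the right context \<open>t\<^sub>2\<close>, because every later
  letter of the run resets it. The left context has by then accumulated the value of the whole run.
\<close>

lemma run_1:
  assumes "set x \<subseteq> A\<^sub>1"
  shows rctx_run_1: "x \<noteq> [] \<Longrightarrow> rctx x t\<^sub>2 = Adj"
    and mid_run_1: "x \<noteq> [] \<Longrightarrow> mid x t\<^sub>1 t\<^sub>2 = merge_s \<chi> \<psi>\<^sub>1 x (t\<^sub>1, t\<^sub>2)"
    and lctx_run_1: "lctx x t\<^sub>1 = t\<^sub>1 * ext_hom \<psi>\<^sub>1 x"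
proof -
  have "(x \<noteq> [] \<longrightarrow> rctx x t\<^sub>2 = Adj \<and> mid x t\<^sub>1 t\<^sub>2 = merge_s \<chi> \<psi>\<^sub>1 x (t\<^sub>1, t\<^sub>2))
    \<and> lctx x t\<^sub>1 = t\<^sub>1 * ext_hom \<psi>\<^sub>1 x"
    using assms
  proof (induction x arbitrary: t\<^sub>1)
    case Nil
    then show ?case by simp
  next
    case (Cons a x)
    then have a: "a \<in> A\<^sub>1" and x: "set x \<subseteq> A\<^sub>1" by auto
    have app: "rctx (a # x) t\<^sub>2 = rctx [a] (rctx x t\<^sub>2)"
      "mid (a # x) t\<^sub>1 t\<^sub>2 = mid [a] t\<^sub>1 (rctx x t\<^sub>2) * mid x (lctx [a] t\<^sub>1) t\<^sub>2"
      "lctx (a # x) t\<^sub>1 = lctx x (lctx [a] t\<^sub>1)"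
      using ctx_append[of "[a]" x] a le_supI1[OF x] by simp_all
    have "mid (a # x) t\<^sub>1 t\<^sub>2 = merge_s \<chi> \<psi>\<^sub>1 (a # x) (t\<^sub>1, t\<^sub>2)"
    proof (cases "x = []")
      case True
      then show ?thesis by (simp add: ctx_letter_1[OF a])
    next
      case False
      have "Elt (\<psi>\<^sub>1 (a # x)) = Elt (\<psi>\<^sub>1 [a]) * Elt (\<psi>\<^sub>1 x)"
        using ext_hom_Cons[OF hom_1 a x] False by (simp add: ext_hom_def)
      moreover have "mid (a # x) t\<^sub>1 t\<^sub>2 = merge_s \<chi> \<psi>\<^sub>1 x (t\<^sub>1 * Elt (\<psi>\<^sub>1 [a]), t\<^sub>2)"
        using False Cons.IH[OF x] by (simp add: app ctx_letter_1[OF a])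
      \<comment> \<open>Products \<open>Elt s * Elt t\<close> stay unevaluated, so that associativity can regroup them.\<close>
      ultimately show ?thesis
        by (cases t\<^sub>2) (simp_all add: mult.assoc del: times_adj.simps(1))
    qed
    then show ?case
      using Cons.IH[OF x] by (simp add: app(1,3) ctx_letter_1[OF a] ext_hom_Cons[OF hom_1 a x] mult.assoc)
  qed
  then show "x \<noteq> [] \<Longrightarrow> rctx x t\<^sub>2 = Adj" "x \<noteq> [] \<Longrightarrow> mid x t\<^sub>1 t\<^sub>2 = merge_s \<chi> \<psi>\<^sub>1 x (t\<^sub>1, t\<^sub>2)"
    "lctx x t\<^sub>1 = t\<^sub>1 * ext_hom \<psi>\<^sub>1 x"
    by blast+
qed

lemma run_2:
  assumes "set y \<subseteq> A\<^sub>2"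
  shows rctx_run_2: "rctx y t\<^sub>2 = ext_hom \<psi>\<^sub>2 y * t\<^sub>2"
    and mid_run_2: "mid y t\<^sub>1 t\<^sub>2 = Adj"
    and lctx_run_2: "y \<noteq> [] \<Longrightarrow> lctx y t\<^sub>1 = Adj"
proof -
  have "rctx y t\<^sub>2 = ext_hom \<psi>\<^sub>2 y * t\<^sub>2 \<and> mid y t\<^sub>1 t\<^sub>2 = Adj \<and> (y \<noteq> [] \<longrightarrow> lctx y t\<^sub>1 = Adj)"
    using assms
  proof (induction y arbitrary: t\<^sub>1)
    case Nil
    then show ?case by simp
  next
    case (Cons a y)
    then have a: "a \<in> A\<^sub>2" and y: "set y \<subseteq> A\<^sub>2" by auto
    have app: "rctx (a # y) t\<^sub>2 = rctx [a] (rctx y t\<^sub>2)"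
      "mid (a # y) t\<^sub>1 t\<^sub>2 = mid [a] t\<^sub>1 (rctx y t\<^sub>2) * mid y (lctx [a] t\<^sub>1) t\<^sub>2"
      "lctx (a # y) t\<^sub>1 = lctx y (lctx [a] t\<^sub>1)"
      using ctx_append[of "[a]" y] a le_supI2[OF y] by simp_all
    show ?case
      using Cons.IH[OF y]
      by (cases "y = []")
        (simp_all add: app ctx_letter_2[OF a] ext_hom_Cons[OF hom_2 a y] mult.assoc)
  qed
  then show "rctx y t\<^sub>2 = ext_hom \<psi>\<^sub>2 y * t\<^sub>2" "mid y t\<^sub>1 t\<^sub>2 = Adj" "y \<noteq> [] \<Longrightarrow> lctx y t\<^sub>1 = Adj"
    by blast+
qed

section \<open>Products of blocks\<close>

lemma block:
  assumes "x \<in> words A\<^sub>1" and "y \<in> words A\<^sub>2"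
  shows rctx_block: "rctx (x @ y) t\<^sub>2 = Adj"
    and mid_block: "mid (x @ y) Adj Adj = Elt (\<chi> [(\<psi>\<^sub>1 x, \<psi>\<^sub>2 y)])"
    and lctx_block: "lctx (x @ y) t\<^sub>1 = Adj"
proof -
  have x: "set x \<subseteq> A\<^sub>1" "x \<noteq> []" and y: "set y \<subseteq> A\<^sub>2" "y \<noteq> []"
    and sub: "set x \<subseteq> A\<^sub>1 \<union> A\<^sub>2" "set y \<subseteq> A\<^sub>1 \<union> A\<^sub>2"
    using assms by auto
  show "rctx (x @ y) t\<^sub>2 = Adj"
    by (simp only: rctx_append[OF sub] rctx_run_1[OF x])
  show "mid (x @ y) Adj Adj = Elt (\<chi> [(\<psi>\<^sub>1 x, \<psi>\<^sub>2 y)])"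
    using x y by (simp add: mid_append[OF sub] mid_run_1 mid_run_2 rctx_run_2 ext_hom_def)
  show "lctx (x @ y) t\<^sub>1 = Adj"
    by (simp only: lctx_append[OF sub] lctx_run_2[OF y])
qed

text \<open>
  The blocks see the contexts \<open>(I\<^sub>1, I\<^sub>2)\<close> independently of each other, since the blocks before and
  after each of them reset the contexts; so their middle components simply multiply.
\<close>

lemma join_blocks:
  assumes "ps \<in> lists (words A\<^sub>1 \<times> words A\<^sub>2)"
  shows rctx_join: "rctx (join ps) Adj = Adj"
    and mid_join: "mid (join ps) Adj Adj = ext_hom \<chi> (map (\<lambda>(x, y). (\<psi>\<^sub>1 x, \<psi>\<^sub>2 y)) ps)"
    and lctx_join: "lctx (join ps) Adj = Adj"
    and set_join: "set (join ps) \<subseteq> A\<^sub>1 \<union> A\<^sub>2"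
proof -
  have "rctx (join ps) Adj = Adj \<and> lctx (join ps) Adj = Adj \<and> set (join ps) \<subseteq> A\<^sub>1 \<union> A\<^sub>2
    \<and> mid (join ps) Adj Adj = ext_hom \<chi> (map (\<lambda>(x, y). (\<psi>\<^sub>1 x, \<psi>\<^sub>2 y)) ps)"
    using assms
  proof (induction ps rule: list.induct)
    case Nil
    then show ?case by simp
  next
    case (Cons p ps)
    obtain x y where p: "p = (x, y)" by fastforce
    have xy: "x \<in> words A\<^sub>1" "y \<in> words A\<^sub>2" and ps: "ps \<in> lists (words A\<^sub>1 \<times> words A\<^sub>2)"
      using Cons.prems by (auto simp: p)
    have sub: "set (x @ y) \<subseteq> A\<^sub>1 \<union> A\<^sub>2" using xy by auto
    note IH = Cons.IH[OF ps]
    have join: "join (p # ps) = (x @ y) @ join ps" by (simp add: p)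
    have "ext_hom \<chi> (map (\<lambda>(x, y). (\<psi>\<^sub>1 x, \<psi>\<^sub>2 y)) (p # ps))
      = Elt (\<chi> [(\<psi>\<^sub>1 x, \<psi>\<^sub>2 y)]) * ext_hom \<chi> (map (\<lambda>(x, y). (\<psi>\<^sub>1 x, \<psi>\<^sub>2 y)) ps)"
      by (simp add: p ext_hom_Cons[OF hom_chi])
    then show ?case
      using IH sub ctx_append[OF sub, of "join ps"] block[OF xy]
      by (simp only: join set_append Un_subset_iff simp_thms)
  qed
  then show "rctx (join ps) Adj = Adj" "lctx (join ps) Adj = Adj"
    "set (join ps) \<subseteq> A\<^sub>1 \<union> A\<^sub>2"
    "mid (join ps) Adj Adj = ext_hom \<chi> (map (\<lambda>(x, y). (\<psi>\<^sub>1 x, \<psi>\<^sub>2 y)) ps)"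
    by blast+
qed

section \<open>Recovering the function \<open>\<tau>\<close>\<close>

lemma tau_eq_ctx:
  assumes "set w \<subseteq> A\<^sub>1 \<union> A\<^sub>2"
  shows "tau A\<^sub>1 A\<^sub>2 \<chi> \<psi>\<^sub>1 \<psi>\<^sub>2 w = (rctx w Adj, mid w Adj Adj, lctx w Adj)"
proof -
  let ?P = "\<lambda>(v\<^sub>2, u, v\<^sub>1). w = v\<^sub>2 @ u @ v\<^sub>1 \<and> v\<^sub>2 \<in> lists A\<^sub>2
    \<and> u \<in> insert [] (sg_generated (blocks A\<^sub>1 A\<^sub>2)) \<and> v\<^sub>1 \<in> lists A\<^sub>1"
  obtain v\<^sub>2 u v\<^sub>1 where the: "(THE t. ?P t) = (v\<^sub>2, u, v\<^sub>1)"
    by (cases "THE t. ?P t")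
  have "?P (THE t. ?P t)"
    by (rule theI'[OF tau_factorization_ex1[OF disjoint]]) (use assms in auto)
  then have w: "w = v\<^sub>2 @ u @ v\<^sub>1" and v: "set v\<^sub>2 \<subseteq> A\<^sub>2" "set v\<^sub>1 \<subseteq> A\<^sub>1"
    and u: "u \<in> insert [] (sg_generated (blocks A\<^sub>1 A\<^sub>2))"
    unfolding the by auto
  obtain ps where ps: "ps \<in> lists (words A\<^sub>1 \<times> words A\<^sub>2)" "u = join ps" "u = [] \<longleftrightarrow> ps = []"
  proof (cases "u = []")
    case True
    then show ?thesis using that[of "[]"] by simp
  next
    case False
    then obtain ps where "ps \<in> lists (words A\<^sub>1 \<times> words A\<^sub>2)" "ps \<noteq> []" "u = join ps"
      using u by (auto simp only: sg_generated_blocks)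
    then show ?thesis using that False by blast
  qed
  have "ext_hom (\<chi> \<circ> block_hom A\<^sub>1 A\<^sub>2 \<psi>\<^sub>1 \<psi>\<^sub>2) u = ext_hom \<chi> (map (\<lambda>(x, y). (\<psi>\<^sub>1 x, \<psi>\<^sub>2 y)) ps)"
    using ps block_hom_join[OF disjoint ps(1), of \<psi>\<^sub>1 \<psi>\<^sub>2] by (auto simp: ext_hom_def)
  then have u0: "ext_hom (\<chi> \<circ> block_hom A\<^sub>1 A\<^sub>2 \<psi>\<^sub>1 \<psi>\<^sub>2) u = mid u Adj Adj"
    using mid_join[OF ps(1)] ps(2) by simp
  have uctx: "rctx u Adj = Adj" "lctx u Adj = Adj" and "set u \<subseteq> A\<^sub>1 \<union> A\<^sub>2"
    using rctx_join[OF ps(1)] lctx_join[OF ps(1)] set_join[OF ps(1)] ps(2) by simp_all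
  then have sub: "set v\<^sub>2 \<subseteq> A\<^sub>1 \<union> A\<^sub>2" "set (u @ v\<^sub>1) \<subseteq> A\<^sub>1 \<union> A\<^sub>2"
    "set u \<subseteq> A\<^sub>1 \<union> A\<^sub>2" "set v\<^sub>1 \<subseteq> A\<^sub>1 \<union> A\<^sub>2"
    using v by auto
  have v1: "rctx v\<^sub>1 Adj = Adj" "mid v\<^sub>1 t Adj = Adj" for t
    using rctx_run_1[OF v(2)] mid_run_1[OF v(2)] by (cases "v\<^sub>1 = []"; simp)+
  have v2: "lctx v\<^sub>2 Adj = Adj"
    using lctx_run_2[OF v(1)] by (cases "v\<^sub>2 = []") simp_all
  have "rctx w Adj = ext_hom \<psi>\<^sub>2 v\<^sub>2"
    by (simp add: w rctx_append[OF sub(1,2)] rctx_append[OF sub(3,4)] v1 uctx rctx_run_2[OF v(1)])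
  moreover have "lctx w Adj = ext_hom \<psi>\<^sub>1 v\<^sub>1"
    by (simp add: w lctx_append[OF sub(1,2)] lctx_append[OF sub(3,4)] v2 uctx lctx_run_1[OF v(2)])
  moreover have "mid w Adj Adj = mid u Adj Adj"
    by (simp add: w mid_append[OF sub(1,2)] mid_append[OF sub(3,4)] v1 v2 mid_run_2[OF v(1)])
  moreover have "tau A\<^sub>1 A\<^sub>2 \<chi> \<psi>\<^sub>1 \<psi>\<^sub>2 w = (ext_hom \<psi>\<^sub>2 v\<^sub>2,
      ext_hom (\<chi> \<circ> block_hom A\<^sub>1 A\<^sub>2 \<psi>\<^sub>1 \<psi>\<^sub>2) u, ext_hom \<psi>\<^sub>1 v\<^sub>1)"
    unfolding tau_def the by (simp add: Let_def)
  ultimately show ?thesis using u0 by simp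
qed

end

theorem proposition2p2:
  fixes A A\<^sub>1 A\<^sub>2 :: "'a set"
    and \<psi>\<^sub>1 :: "'a list \<Rightarrow> 't\<^sub>1::{semigroup_mult, finite}"
    and \<psi>\<^sub>2 :: "'a list \<Rightarrow> 't\<^sub>2::{semigroup_mult, finite}"
    and \<chi> :: "('t\<^sub>1 \<times> 't\<^sub>2) list \<Rightarrow> 't\<^sub>0::semigroup_mult"
  assumes "finite A" and "A = A\<^sub>1 \<union> A\<^sub>2" and "A\<^sub>1 \<inter> A\<^sub>2 = {}"
    and "sg_hom_on (words A\<^sub>1) (*) \<psi>\<^sub>1"
    and "sg_hom_on (words A\<^sub>2) (*) \<psi>\<^sub>2"
    and "sg_hom_on (words UNIV) (*) \<chi>"
  shows "\<exists>f :: ('t\<^sub>0, 't\<^sub>1, 't\<^sub>2) merge_sg \<Rightarrow> 't\<^sub>2 adj \<times> 't\<^sub>0 adj \<times> 't\<^sub>1 adj.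
    \<forall>w\<in>words A. (f \<circ> merge_decomposition A\<^sub>1 A\<^sub>2 \<chi> \<psi>\<^sub>1 \<psi>\<^sub>2) w = tau A\<^sub>1 A\<^sub>2 \<chi> \<psi>\<^sub>1 \<psi>\<^sub>2 w"
proof -
  interpret merge_data A\<^sub>1 A\<^sub>2 \<psi>\<^sub>1 \<psi>\<^sub>2 \<chi>
    by unfold_locales (fact assms)+
  let ?f = "\<lambda>(s\<^sub>R, s, s\<^sub>L). (flat_app s\<^sub>R Adj, s (Adj, Adj), sharp_app s\<^sub>L Adj)"
  have "?f (h w) = tau A\<^sub>1 A\<^sub>2 \<chi> \<psi>\<^sub>1 \<psi>\<^sub>2 w" if "w \<in> words A" for w
    using that assms(2) tau_eq_ctx[of w]
    by (cases "h w") (simp add: rctx_def mid_def lctx_def)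
  then show ?thesis
    by (intro exI[of _ ?f] ballI) (simp only: comp_apply)
qed

end
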